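(* Let $G=(V,A)$ be a routing graph with conditional fare network $\mathcal N=(\mathcal T,\Gamma,w,e,\mu,\pi)$, and let $C=(C_F,C_P,C_N)$ be a partition of the ticket set $T$ into three disjoint sets such that the associated relation $\leq_C$ on fare states satisfies the monotonicity condition $$\forall f_1,f_2\in F:\quad f_1\leq_C f_2 \Longrightarrow \forall a\in A:\ \mathrm{Up}(f_1,a)\leq_C \mathrm{Up}(f_2,a).$$ Let $s,t\in V$ and let $p^*\in P^f_{s,t}$ be a state-optimal $s,t$-path in $G$. Then there is a path $p'=(s=v_0,v_1,\dots,v_{n-1},v_n=t)\in P^f_{s,t}$ with $f(p^* )=f(p')$ such that every subpath $p''=(v_0,\dots,v_l)$, $l<n$, of $p'$ is a state-optimal $v_0,v_l$-path.
   Context: All directed graphs are finite. A partially ordered positive monoid $(H,+,\leq)$ is a set $H$ with an associative operation $+$ and neutral element $\mathbf 0$, together with a partial order $\leq$ on $H$ such that $h_1\leq h_2\Rightarrow h_1+x\leq h_2+x$ for all $h_1,h_2,x\in H$, and $\mathbf 0\leq h$ for all $h\in H$. Let $G=(V,A)$ be a directed graph (the routing graph). An $s,t$-path is a sequence of vertices $(v_0,\dots,v_n)$ with $v_0=s$, $v_n=t$ and $(v_{i-1},v_i)\in A$ for all $i$; vertices may repeat. $P_{s,t}$ is the set of all $s,t$-paths in $G$. A conditional fare network (CFN) $(\mathcal T,\Gamma,w,e,\mu,\pi)$ of $G$ consists of: (1) a finite directed acyclic graph $\mathcal T=(T,E)$ (the ticket graph; elements of $T$ are tickets) with a ticket transition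 function $\Gamma:T\times H\times S\to T$, where $(H,+,\leq)$ is a partially ordered positive monoid and $S$ is a set of fare events, such that $\Gamma(\tau,h,s)\in\delta^+(\tau)\cup\{\tau\}$ for all $\tau\in T,h\in H,s\in S$ ($\delta^+(\tau)$ is the set of out-neighbours of $\tau$ in $\mathcal T$); (2) arc weights $w:A\to H$; (3) arc events $e:A\to S$; (4) initial fare states $\mu:V\to F$, where $F:=T\times H$ is the set of fare states; (5) a price function $\pi:T\to\mathbb Q_{\geq 0}$ that is non-decreasing along directed paths of $\mathcal T$. For a fare state $f\in F$ write $f=(\tau(f),w(f))$ with $\tau(f)\in T$, $w(f)\in H$. The fare update function $\mathrm{Up}:F\times A\to F$ is given by $g=\mathrm{Up}(f,a)$ with $w(g)=w(f)+w(a)$ and $\tau(g)=\Gamma(\tau(f),w(g),e(a))$. The fare state $f(p)$ of a path $p=(v_0,\dots,v_n)$ is $f_n$, where $f_0=\mu(v_0)$ and $f_i=\mathrm{Up}(f_{i-1},(v_{i-1},v_i))$. Given a partition $C=(C_F,C_P,C_N)$ of $T$ and fare states $f_1=(\tau_1,h_1)$, $f_2=(\tau_2,h_2)$, define $f_1\leq_C f_2$ if and only if $\tau_1\notin C_N$, $h_1\leq h_2$, and: $\tau_1=\tau_2$ if $\tau_1\in C_P$; there is a directed $\tau_1,\tau_2$-path in $\mathcal T$ (possibly of length zero) if $\tau_1\in C_F$. Write $f_1<_C f_2$ if $f_1\leq_C f_2$ and ($h_1<h_2$ or $\tau_1\neq\tau_2$). An $s,t$-path $p^*$ is state-optimal if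 there is no $s,t$-path $p$ with $f(p)<_C f(p^* )$; $P^f_{s,t}$ is the set of all state-optimal $s,t$-paths.
   Formalization: The order on H is also assumed compatible on the left (h1 ≤ h2 implies x+h1 ≤ x+h2), which is automatic if + is commutative; with only right compatibility and non-commutative + the claim fails. *)

theory Defs
  imports Complex_Main
begin

text \<open>
  The monoid is not assumed to be commutative. Compatibility of the order with the addition
  is required on both sides; if the addition commutes, \<open>add_right_comp\<close> and \<open>add_left_comp\<close> are
  the same axiom. Without commutativity, \<open>add_right_comp\<close> and \<open>zero_least\<close> alone do not even
  yield \<open>h \<le> h + x\<close>: an arc appended to a path could then lower its weight, paths through a
  directed cycle could have ever smaller fare states, and there might be no state-optimal path
  between two connected vertices.
\<close>

class po_positive_monoid = monoid_add + order +
  assumes add_right_comp: "h1 \<le> h2 \<Longrightarrow> h1 + x \<le> h2 + x"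
    and add_left_comp: "h1 \<le> h2 \<Longrightarrow> x + h1 \<le> x + h2"
    and zero_least: "0 \<le> h"

definition digraph :: "'v set \<Rightarrow> ('v \<times> 'v) set \<Rightarrow> bool" where
  "digraph V A \<longleftrightarrow> finite V \<and> A \<subseteq> V \<times> V"

text \<open>Paths are nonempty vertex lists; vertices may repeat, and \<open>[s]\<close> is a path from \<open>s\<close> to \<open>s\<close>.\<close>

definition st_paths :: "'v set \<Rightarrow> ('v \<times> 'v) set \<Rightarrow> 'v \<Rightarrow> 'v \<Rightarrow> 'v list set" where
  "st_paths V A s t = {p. p \<noteq> [] \<and> set p \<subseteq> V \<and> hd p = s \<and> last p = t \<and>
     successively (\<lambda>u v. (u, v) \<in> A) p}"

text \<open>
  A fare state is a pair of a ticket and a weight. Only the values of the functions on the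
  tickets, the events, the vertices and the arcs matter.
\<close>

record ('v, 't, 'h, 's) fare_network =
  tickets :: "'t set"
  ticket_arcs :: "('t \<times> 't) set"
  events :: "'s set"
  transition :: "'t \<Rightarrow> 'h \<Rightarrow> 's \<Rightarrow> 't"
  arc_weight :: "'v \<times> 'v \<Rightarrow> 'h"
  arc_event :: "'v \<times> 'v \<Rightarrow> 's"
  init_state :: "'v \<Rightarrow> 't \<times> 'h"
  price :: "'t \<Rightarrow> rat"

definition fare_states :: "('v, 't, 'h, 's) fare_network \<Rightarrow> ('t \<times> 'h) set" where
  "fare_states N = tickets N \<times> UNIV"

definition conditional_fare_network ::
  "'v set \<Rightarrow> ('v \<times> 'v) set \<Rightarrow> ('v, 't, 'h::po_positive_monoid, 's) fare_network \<Rightarrow> bool" where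
  "conditional_fare_network V A N \<longleftrightarrow>
     digraph (tickets N) (ticket_arcs N) \<and> acyclic (ticket_arcs N) \<and>
     (\<forall>\<tau>\<in>tickets N. \<forall>h. \<forall>s\<in>events N. transition N \<tau> h s \<in> ticket_arcs N `` {\<tau>} \<union> {\<tau>}) \<and>
     (\<forall>a\<in>A. arc_event N a \<in> events N) \<and>
     (\<forall>v\<in>V. init_state N v \<in> fare_states N) \<and>
     (\<forall>\<tau>\<in>tickets N. 0 \<le> price N \<tau>) \<and>
     (\<forall>\<tau>\<in>tickets N. \<forall>\<tau>'\<in>tickets N. (\<tau>, \<tau>') \<in> (ticket_arcs N)\<^sup>* \<longrightarrow> price N \<tau> \<le> price N \<tau>')"

definition update ::
  "('v, 't, 'h::po_positive_monoid, 's) fare_network \<Rightarrow> 't \<times> 'h \<Rightarrow> 'v \<times> 'v \<Rightarrow> 't \<times> 'h" where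
  "update N f a = (transition N (fst f) (snd f + arc_weight N a) (arc_event N a),
     snd f + arc_weight N a)"

definition fare_state ::
  "('v, 't, 'h::po_positive_monoid, 's) fare_network \<Rightarrow> 'v list \<Rightarrow> 't \<times> 'h" where
  "fare_state N p = foldl (update N) (init_state N (hd p)) (zip p (tl p))"

text \<open>The parts of the partition may be empty.\<close>

definition ticket_partition :: "'t set \<Rightarrow> 't set \<Rightarrow> 't set \<Rightarrow> 't set \<Rightarrow> bool" where
  "ticket_partition T CF CP CN \<longleftrightarrow>
     CF \<union> CP \<union> CN = T \<and> CF \<inter> CP = {} \<and> CF \<inter> CN = {} \<and> CP \<inter> CN = {}"

definition state_le ::
  "('v, 't, 'h::po_positive_monoid, 's) fare_network \<Rightarrow> 't set \<times> 't set \<times> 't set \<Rightarrow>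
     't \<times> 'h \<Rightarrow> 't \<times> 'h \<Rightarrow> bool" where
  "state_le N = (\<lambda>(CF, CP, CN) (\<tau>1, h1) (\<tau>2, h2).
     \<tau>1 \<notin> CN \<and> h1 \<le> h2 \<and>
     (\<tau>1 \<in> CP \<longrightarrow> \<tau>1 = \<tau>2) \<and>
     (\<tau>1 \<in> CF \<longrightarrow> (\<tau>1, \<tau>2) \<in> (ticket_arcs N)\<^sup>*))"

definition state_less ::
  "('v, 't, 'h::po_positive_monoid, 's) fare_network \<Rightarrow> 't set \<times> 't set \<times> 't set \<Rightarrow>
     't \<times> 'h \<Rightarrow> 't \<times> 'h \<Rightarrow> bool" where
  "state_less N C f1 f2 \<longleftrightarrow> state_le N C f1 f2 \<and> (snd f1 < snd f2 \<or> fst f1 \<noteq> fst f2)"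

definition state_optimal_paths ::
  "'v set \<Rightarrow> ('v \<times> 'v) set \<Rightarrow> ('v, 't, 'h::po_positive_monoid, 's) fare_network \<Rightarrow>
     't set \<times> 't set \<times> 't set \<Rightarrow> 'v \<Rightarrow> 'v \<Rightarrow> 'v list set" where
  "state_optimal_paths V A N C s t = {q \<in> st_paths V A s t.
     \<not> (\<exists>p\<in>st_paths V A s t. state_less N C (fare_state N p) (fare_state N q))}"

end

theory Submission
  imports Defs "HOL-Library.Infinite_Set"
begin

text \<open>
  If a prefix \<open>q\<close> of an optimal path \<open>p\<close> is not optimal, it can be exchanged for an optimal path
  \<open>q'\<close> with a smaller fare state. By monotonicity the fare state at the end does not get worse, and
  as \<open>p\<close> is optimal it stays the same. What needs an argument is that such exchanges come to an end
  and that optimal paths below \<open>q\<close> exist at all: paths may repeat vertices, there are infinitely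
  many of them, and \<open>q'\<close> may be longer than \<open>q\<close> and have suboptimal prefixes itself.

  Both points rest on one well-founded order, which compares fare states by their weights and, for
  equal weights, by the position of the tickets in the acyclic ticket graph. It contains \<open><\<^sub>C\<close>,
  and traversing an arc never decreases it, as weights are nonnegative and tickets only
  move along ticket arcs. An order on an infinite monoid need not be well-founded, but here only the
  weights of paths from \<open>s\<close> matter, and apart from the initial weight these are sums of
  the finitely many arc weights. Such sums are well-quasi-ordered (\<open>sums_well_quasi_ordered\<close>),
  which is Higman's lemma for a finite alphabet, read in the monoid.

  Hence every path has an optimal path at or below it (\<open>optimal_path_below\<close>), and the theorem follows
  by induction on the fare state in this order and, for equal fare states, on the length
  (\<open>ex_prefix_optimal\<close>). Given an optimal path \<open>q @ [v]\<close>, pick \<open>q' = q\<close> if \<open>q\<close> is optimal, which is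
  shorter and has no larger state, and otherwise an optimal \<open>q'\<close> with a smaller state than \<open>q\<close>;
  the induction hypothesis for \<open>q'\<close> yields a path to which \<open>v\<close> can be appended.
\<close>

section \<open>Sums of finitely many elements of an ordered positive monoid\<close>

lemma le_add_left: "h \<le> x + (h :: 'h::po_positive_monoid)"
  using add_right_comp[OF zero_least, of h x] by simp

lemma le_add_right: "h \<le> h + (x :: 'h::po_positive_monoid)"
  using add_left_comp[OF zero_least, of h x] by simp

text \<open>
  The proof is the minimal bad sequence argument of Nash-Williams, run on words over \<open>W\<close>
  but compared by their sums. The comparison of sums plays the part of the subword order: it is
  preserved when a letter is put in front of both words, and a word lies below its
  extensions.
\<close>

lemma sums_well_quasi_ordered:
  fixes W :: "'h::po_positive_monoid set" and a :: "nat \<Rightarrow> 'h list"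
  assumes "finite W" and "\<And>i. set (a i) \<subseteq> W"
  shows "\<exists>i j. i < j \<and> sum_list (a i) \<le> sum_list (a j)"
proof (rule ccontr)
  define bad :: "(nat \<Rightarrow> 'h list) \<Rightarrow> bool" where
    "bad g \<longleftrightarrow> (\<forall>i. set (g i) \<subseteq> W) \<and> (\<forall>i j. i < j \<longrightarrow> \<not> sum_list (g i) \<le> sum_list (g j))" for g
  assume "\<not> ?thesis"
  with assms(2) have "bad a" unfolding bad_def by blast
  define P where "P f n r \<longleftrightarrow> (\<exists>g. bad g \<and> (\<forall>i<n. g i = f i) \<and> g n = r \<and>
      (\<forall>g'. bad g' \<and> (\<forall>i<n. g' i = f i) \<longrightarrow> length r \<le> length (g' n)))" for f n r
  have "\<exists>f. \<forall>n. P f n (f n)"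
  proof (rule dependent_wf_choice)
    show "wf {(i, j :: nat). i < j}" by (rule wf)
  next
    fix f g :: "nat \<Rightarrow> 'h list" and n r
    assume "\<And>z. (z, n) \<in> {(i, j). i < j} \<Longrightarrow> f z = g z"
    then show "P f n r = P g n r" unfolding P_def by simp
  next
    fix n f
    assume prev: "\<And>m. (m, n) \<in> {(i, j). i < j} \<Longrightarrow> P f m (f m)"
    have "\<exists>g. bad g \<and> (\<forall>i<n. g i = f i)"
    proof (cases n)
      case 0
      with \<open>bad a\<close> show ?thesis by auto
    next
      case (Suc m)
      with prev[of m] obtain g where "bad g" "\<forall>i<m. g i = f i" "g m = f m"
        unfolding P_def by auto
      with Suc show ?thesis by (auto simp: less_Suc_eq)
    qed
    then obtain g where "bad g \<and> (\<forall>i<n. g i = f i)"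
      and "\<And>g'. bad g' \<and> (\<forall>i<n. g' i = f i) \<Longrightarrow> length (g n) \<le> length (g' n)"
      using ex_has_least_nat[of "\<lambda>g. bad g \<and> (\<forall>i<n. g i = f i)" _ "\<lambda>g. length (g n)"] by blast
    then show "\<exists>r. P f n r" unfolding P_def by blast
  qed
  then obtain f where f: "P f n (f n)" for n by blast
  have "bad f"
    unfolding bad_def
  proof (intro conjI allI impI)
    fix i show "set (f i) \<subseteq> W"
      using f[of i] unfolding P_def bad_def by metis
  next
    fix i j :: nat assume "i < j"
    then show "\<not> sum_list (f i) \<le> sum_list (f j)"
      using f[of j] unfolding P_def bad_def by metis
  qed
  have minimal: "length (f n) \<le> length (g n)" if "bad g" "\<forall>i<n. g i = f i" for g n
    using f[of n] that unfolding P_def by blast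
  have nonempty: "f i \<noteq> []" for i
  proof
    assume "f i = []"
    then have "sum_list (f i) \<le> sum_list (f (Suc i))" by (simp add: zero_least)
    with \<open>bad f\<close> show False unfolding bad_def by blast
  qed
  have "hd (f i) \<in> W" for i
    using nonempty[of i] \<open>bad f\<close> unfolding bad_def by (metis hd_in_set subsetD)
  then have "range (\<lambda>i. hd (f i)) \<subseteq> W" by blast
  then have "finite (range (\<lambda>i. hd (f i)))"
    using \<open>finite W\<close> finite_subset by blast
  then obtain k where "infinite {i. hd (f i) = hd (f k)}"
    using pigeonhole_infinite[of "UNIV :: nat set" "\<lambda>i. hd (f i)"] by auto
  then obtain r :: "nat \<Rightarrow> nat" where r: "strict_mono r" "\<And>i. hd (f (r i)) = hd (f k)"
    using infinite_enumerate[of "{i. hd (f i) = hd (f k)}"] by blast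
  define c where "c = hd (f k)"
  define b where "b i = tl (f (r i))" for i
  have fr: "f (r i) = c # b i" for i
    unfolding b_def c_def using r(2)[of i] nonempty[of "r i"] by (metis list.collapse)
  \<comment> \<open>Up to the first word with the frequent letter \<open>c\<close>, keep the sequence; from there on, use the
    words starting with \<open>c\<close>, with this letter removed. The result is bad again, but
    has a shorter word at position \<open>r 0\<close>.\<close>
  define g where "g i = (if i < r 0 then f i else b (i - r 0))" for i
  have "bad g"
    unfolding bad_def
  proof (intro conjI allI impI)
    fix i
    have "set (b j) \<subseteq> W" for j
      using \<open>bad f\<close> fr[of j] unfolding bad_def by (metis set_subset_Cons subset_trans)
    then show "set (g i) \<subseteq> W" using \<open>bad f\<close> unfolding g_def bad_def by simp
  next
    fix i j :: nat assume "i < j"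
    have badD: "\<not> sum_list (f i') \<le> sum_list (f j')" if "i' < j'" for i' j'
      using \<open>bad f\<close> that unfolding bad_def by blast
    consider "j < r 0" | "i < r 0" "r 0 \<le> j" | "r 0 \<le> i" by linarith
    then show "\<not> sum_list (g i) \<le> sum_list (g j)"
    proof cases
      case 1
      with \<open>i < j\<close> badD show ?thesis unfolding g_def by simp
    next
      case 2
      then have "i < r (j - r 0)"
        using strict_mono_less_eq[OF r(1), of 0 "j - r 0"] by simp
      from badD[OF this] have "\<not> sum_list (f i) \<le> c + sum_list (b (j - r 0))" by (simp add: fr)
      then show ?thesis using 2 order_trans[OF _ le_add_left] unfolding g_def by auto
    next
      case 3
      then have "r (i - r 0) < r (j - r 0)"
        using \<open>i < j\<close> strict_mono_less[OF r(1)] by auto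
      from badD[OF this] have "\<not> c + sum_list (b (i - r 0)) \<le> c + sum_list (b (j - r 0))"
        by (simp add: fr)
      then show ?thesis using 3 \<open>i < j\<close> add_left_comp unfolding g_def by auto
    qed
  qed
  then have "length (f (r 0)) \<le> length (g (r 0))"
    by (rule minimal) (simp add: g_def)
  then show False by (simp add: fr g_def)
qed

lemma wf_less_translated_sums:
  fixes W :: "'h::po_positive_monoid set"
  assumes "finite W"
  shows "wf {(x, y). x < y \<and> x \<in> {h + sum_list ws |ws. set ws \<subseteq> W} \<and>
                            y \<in> {h + sum_list ws |ws. set ws \<subseteq> W}}"
    (is "wf ?R")
  unfolding wf_iff_no_infinite_down_chain
proof
  assume "\<exists>x. \<forall>i. (x (Suc i), x i) \<in> ?R"
  then obtain x where x: "\<And>i. (x (Suc i), x i) \<in> ?R" by blast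
  then have "\<forall>i. \<exists>ws. set ws \<subseteq> W \<and> x i = h + sum_list ws" by blast
  then obtain a where a: "\<And>i. set (a i) \<subseteq> W" "\<And>i. x i = h + sum_list (a i)" by metis
  from sums_well_quasi_ordered[OF assms a(1)]
  obtain i j where "i < j" "sum_list (a i) \<le> sum_list (a j)" by blast
  then have "x i \<le> x j" by (simp add: a(2) add_left_comp)
  moreover have "x j < x i"
  proof -
    have "x (Suc n) < x n" for n using x[of n] by simp
    then have "x j \<le> x (Suc i)" "x (Suc i) < x i"
      using lift_Suc_antimono_le[of x "Suc i" j] \<open>i < j\<close> by (auto simp: less_imp_le)
    then show ?thesis by simp
  qed
  ultimately show False by simp
qed

section \<open>Paths and their fare states\<close>

lemma st_paths_snocI:
  assumes "q \<in> st_paths V A s u" "(u, v) \<in> A" "v \<in> V"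
  shows "q @ [v] \<in> st_paths V A s v"
  using assms by (auto simp: st_paths_def successively_append_iff)

lemma st_paths_cases [consumes 1, case_names single snoc]:
  assumes "p \<in> st_paths V A s v"
  obtains "p = [s]" "v = s" "s \<in> V"
  | q u where "p = q @ [v]" "q \<in> st_paths V A s u" "(u, v) \<in> A" "v \<in> V"
proof (cases p rule: rev_cases)
  case Nil
  with assms show ?thesis by (simp add: st_paths_def)
next
  case (snoc q x)
  show ?thesis
  proof (cases "q = []")
    case True
    with snoc assms that(1) show ?thesis by (auto simp: st_paths_def)
  next
    case False
    with snoc assms have "q \<in> st_paths V A s (last q)" "(last q, v) \<in> A" "v \<in> V" "x = v"
      by (auto simp: st_paths_def successively_append_iff)
    with snoc that(2) show ?thesis by blast
  qed
qed

lemma st_paths_induct [consumes 1, case_names single snoc]: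
  assumes "p \<in> st_paths V A s v"
    and "s \<in> V \<Longrightarrow> Q s [s]"
    and "\<And>q u v. q \<in> st_paths V A s u \<Longrightarrow> (u, v) \<in> A \<Longrightarrow> v \<in> V \<Longrightarrow> Q u q \<Longrightarrow> Q v (q @ [v])"
  shows "Q v p"
  using assms(1)
proof (induction p arbitrary: v rule: length_induct)
  case (1 p)
  from "1.prems" show ?case
  proof (cases rule: st_paths_cases)
    case single
    with assms(2) show ?thesis by simp
  next
    case (snoc q u)
    with "1.IH" assms(3) show ?thesis by simp
  qed
qed

lemma fare_state_singleton [simp]: "fare_state N [v] = init_state N v"
  by (simp add: fare_state_def)

lemma fare_state_snoc:
  assumes "q \<in> st_paths V A s u"
  shows "fare_state N (q @ [v]) = update N (fare_state N q) (u, v)"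
proof -
  have "zip (q @ [v]) (tl (q @ [v])) = zip q (tl q) @ [(last q, v)]" if "q \<noteq> []"
    using that by (induction q rule: list_nonempty_induct) (auto simp: neq_Nil_conv)
  with assms show ?thesis
    by (simp add: fare_state_def st_paths_def)
qed

lemma state_optimal_path_if_same_state:
  assumes "q \<in> state_optimal_paths V A N C s v" "p \<in> st_paths V A s v"
    and "fare_state N p = fare_state N q"
  shows "p \<in> state_optimal_paths V A N C s v"
  using assms by (simp add: state_optimal_paths_def)

section \<open>The order on fare states\<close>

text \<open>
  In \<open>\<le>\<^sub>C\<close>, the fare states before and after an arc can be incomparable: the ticket may leave
  \<open>C\<^sub>P\<close>, or it may be in \<open>C\<^sub>N\<close>. Ignoring the partition makes the fare states along a path
  comparable. The weight comes first, so that the order is a lexicographic product of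
  well-founded orders.
\<close>

definition state_order ::
  "('v, 't, 'h::po_positive_monoid, 's) fare_network \<Rightarrow> (('t \<times> 'h) \<times> ('t \<times> 'h)) set" where
  "state_order N = {(f, g). snd f < snd g \<or>
     snd f = snd g \<and> (fst f, fst g) \<in> (ticket_arcs N)\<^sup>+}"

lemma trans_state_order: "trans (state_order N)"
  by (rule transI) (auto simp: state_order_def dest: less_trans trancl_trans)

text \<open>
  The fixed start vertex \<open>s\<close> matters: all weights considered are then the initial weight at \<open>s\<close>
  plus a sum of arc weights.
\<close>

locale monotone_fare_network =
  fixes V :: "'v set" and A :: "('v \<times> 'v) set"
    and N :: "('v, 't, 'h::po_positive_monoid, 's) fare_network"
    and CF CP CN :: "'t set" and s :: 'v
  assumes digraph: "digraph V A"
    and network: "conditional_fare_network V A N"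
    and partition: "ticket_partition (tickets N) CF CP CN"
    and monotone: "\<And>f1 f2 a. f1 \<in> fare_states N \<Longrightarrow> f2 \<in> fare_states N \<Longrightarrow>
      state_le N (CF, CP, CN) f1 f2 \<Longrightarrow> a \<in> A \<Longrightarrow>
      state_le N (CF, CP, CN) (update N f1 a) (update N f2 a)"
begin

abbreviation le_C (infix "\<le>\<^sub>C" 50) where "f \<le>\<^sub>C g \<equiv> state_le N (CF, CP, CN) f g"
abbreviation less_C (infix "<\<^sub>C" 50) where "f <\<^sub>C g \<equiv> state_less N (CF, CP, CN) f g"
abbreviation "paths \<equiv> st_paths V A s"
abbreviation "optimal_paths \<equiv> state_optimal_paths V A N (CF, CP, CN) s"

lemma update_ticket:
  assumes "f \<in> fare_states N" "a \<in> A"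
  shows "fst (update N f a) = fst f \<or> (fst f, fst (update N f a)) \<in> ticket_arcs N"
proof -
  have "fst f \<in> tickets N" using assms(1) by (cases f) (simp add: fare_states_def)
  then have "transition N (fst f) h (arc_event N a) \<in> ticket_arcs N `` {fst f} \<union> {fst f}" for h
    using assms(2) network unfolding conditional_fare_network_def by blast
  then show ?thesis unfolding update_def fst_conv by blast
qed

lemma update_in_fare_states:
  assumes "f \<in> fare_states N" "a \<in> A"
  shows "update N f a \<in> fare_states N"
proof -
  have "ticket_arcs N \<subseteq> tickets N \<times> tickets N"
    using network by (simp add: conditional_fare_network_def digraph_def)
  then show ?thesis
    using update_ticket[OF assms] assms(1) unfolding fare_states_def mem_Times_iff by force
qed

lemma fare_state_in_fare_states:
  assumes "p \<in> paths v"
  shows "fare_state N p \<in> fare_states N"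
  using assms
proof (induction rule: st_paths_induct)
  case single
  then show ?case using network by (simp add: conditional_fare_network_def)
next
  case (snoc q u v)
  then show ?case by (simp add: fare_state_snoc update_in_fare_states)
qed

lemma update_increases_state_order:
  assumes "f \<in> fare_states N" "a \<in> A"
  shows "f = update N f a \<or> (f, update N f a) \<in> state_order N"
proof -
  note update_ticket[OF assms]
  moreover have "snd f < snd (update N f a) \<or> snd f = snd (update N f a)"
    unfolding order_le_less[symmetric] by (simp add: update_def le_add_right)
  ultimately show ?thesis
    unfolding state_order_def prod_eq_iff mem_Collect_eq case_prod_conv
    by (metis r_into_trancl)
qed

lemma state_le_trans:
  assumes "f \<in> fare_states N" "g \<in> fare_states N" "f \<le>\<^sub>C g" "g \<le>\<^sub>C h"
  shows "f \<le>\<^sub>C h"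
  using assms partition
  by (cases f; cases g; cases h)
    (auto simp: state_le_def ticket_partition_def fare_states_def intro: rtrancl_trans)

text \<open>
  At equal weights, \<open><\<^sub>C\<close> asks for a ticket path between different tickets, whereas \<open>state_order\<close>
  asks for a nontrivial one. This is the same because the ticket graph is acyclic.
\<close>

lemma state_less_iff:
  assumes "f \<in> fare_states N"
  shows "f <\<^sub>C g \<longleftrightarrow> f \<le>\<^sub>C g \<and> (f, g) \<in> state_order N"
proof -
  have "fst f \<in> CF \<or> fst f \<in> CP" if "f \<le>\<^sub>C g"
    using that assms partition
    by (auto simp: state_le_def ticket_partition_def fare_states_def split: prod.splits)
  moreover have "acyclic (ticket_arcs N)"
    using network by (simp add: conditional_fare_network_def)
  ultimately show ?thesis
    by (cases f; cases g)
      (auto simp: state_less_def state_le_def state_order_def acyclic_def rtrancl_eq_or_trancl)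
qed

lemma less_C_trans:
  assumes "f \<in> fare_states N" "g \<in> fare_states N" "f <\<^sub>C g" "g <\<^sub>C h"
  shows "f <\<^sub>C h"
  using assms state_le_trans transD[OF trans_state_order]
  unfolding state_less_iff[OF assms(1)] state_less_iff[OF assms(2)] by blast

lemma same_state_if_le_optimal:
  assumes "q \<in> optimal_paths v" "p \<in> paths v" "fare_state N p \<le>\<^sub>C fare_state N q"
  shows "fare_state N p = fare_state N q"
proof -
  have "\<not> fare_state N p <\<^sub>C fare_state N q"
    using assms by (auto simp: state_optimal_paths_def)
  then show ?thesis using assms(3)
    by (auto simp: state_less_def state_le_def prod_eq_iff split: prod.splits)
qed

lemma path_weight_is_sum:
  assumes "p \<in> paths v"
  shows "snd (fare_state N p) \<in>
    {snd (init_state N s) + sum_list ws |ws. set ws \<subseteq> arc_weight N ` A}"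
  using assms
proof (induction rule: st_paths_induct)
  case single
  show ?case by (auto intro: exI[of _ "[]"])
next
  case (snoc q u v)
  then obtain ws where "set ws \<subseteq> arc_weight N ` A"
    "snd (fare_state N q) = snd (init_state N s) + sum_list ws" by blast
  with snoc show ?case
    by (auto simp: fare_state_snoc update_def add.assoc
        intro!: exI[of _ "ws @ [arc_weight N (u, v)]"])
qed

text \<open>
  The length makes the order strict on a path and its prefix with the same fare state.
\<close>

definition path_order :: "('v list \<times> 'v list) set" where
  "path_order = {(p, q). (\<exists>u. p \<in> paths u) \<and> (\<exists>v. q \<in> paths v) \<and>
     ((fare_state N p, fare_state N q) \<in> state_order N \<or>
      fare_state N p = fare_state N q \<and> length p < length q)}"

lemma wf_path_order: "wf path_order"
proof -
  define S where "S = {snd (init_state N s) + sum_list ws |ws. set ws \<subseteq> arc_weight N ` A}"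
  have "finite A" using digraph finite_subset[of A "V \<times> V"] by (auto simp: digraph_def)
  then have "wf {(x, y). x < y \<and> x \<in> S \<and> y \<in> S}"
    unfolding S_def by (intro wf_less_translated_sums) simp
  moreover have "finite (ticket_arcs N)" "acyclic (ticket_arcs N)"
    using network finite_subset[of "ticket_arcs N" "tickets N \<times> tickets N"]
    by (auto simp: conditional_fare_network_def digraph_def)
  then have "wf ((ticket_arcs N)\<^sup>+)"
    by (intro wf_trancl finite_acyclic_wf)
  ultimately have "wf (inv_image
      ({(x, y). x < y \<and> x \<in> S \<and> y \<in> S} <*lex*> (ticket_arcs N)\<^sup>+ <*lex*> less_than)
      (\<lambda>p. (snd (fare_state N p), fst (fare_state N p), length p)))" (is "wf ?R")
    by (intro wf_inv_image wf_lex_prod wf_less_than)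
  moreover have "path_order \<subseteq> ?R"
    using path_weight_is_sum
    by (auto simp: path_order_def state_order_def S_def in_inv_image)
  ultimately show ?thesis by (rule wf_subset)
qed

section \<open>Exchanging prefixes\<close>

text \<open>
  Descending along \<open><\<^sub>C\<close> ends at an optimal path, and by transitivity this path is
  below the first one.
\<close>

lemma optimal_path_below:
  assumes "q \<in> paths v" "q \<notin> optimal_paths v"
  shows "\<exists>q'\<in>optimal_paths v. fare_state N q' <\<^sub>C fare_state N q"
  using wf_path_order assms
proof (induction q rule: wf_induct_rule)
  case (less q)
  then obtain p where p: "p \<in> paths v" "fare_state N p <\<^sub>C fare_state N q"
    by (auto simp: state_optimal_paths_def)
  show ?case
  proof (cases "p \<in> optimal_paths v")
    case True
    with p show ?thesis by blast
  next
    case False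
    have "(p, q) \<in> path_order"
      using p less.prems fare_state_in_fare_states state_less_iff by (auto simp: path_order_def)
    with less.IH p False obtain q' where q': "q' \<in> optimal_paths v"
      "fare_state N q' <\<^sub>C fare_state N p" by blast
    moreover from q' have "q' \<in> paths v" by (simp add: state_optimal_paths_def)
    ultimately show ?thesis using p fare_state_in_fare_states less_C_trans by blast
  qed
qed

text \<open>
  Optimality of the full path is included among the prefixes, so that a vertex can be
  appended in the induction step.
\<close>

lemma ex_prefix_optimal:
  assumes "p \<in> optimal_paths v"
  shows "\<exists>p'\<in>optimal_paths v. fare_state N p = fare_state N p' \<and>
    (\<forall>l < length p'. take (Suc l) p' \<in> optimal_paths (p' ! l))"
  using wf_path_order assms
proof (induction p arbitrary: v rule: wf_induct_rule)
  case (less p)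
  have "p \<in> paths v" using less.prems by (simp add: state_optimal_paths_def)
  then show ?case
  proof (cases rule: st_paths_cases)
    case single
    with less.prems show ?thesis by (intro bexI[of _ p]) auto
  next
    case q: (snoc q u)
    have p_state: "fare_state N p = update N (fare_state N q) (u, v)"
      using q by (simp add: fare_state_snoc)
    have q_fare: "fare_state N q \<in> fare_states N"
      using q(2) by (rule fare_state_in_fare_states)
    have q_p: "fare_state N q = fare_state N p \<or> (fare_state N q, fare_state N p) \<in> state_order N"
      unfolding p_state using q_fare q(3) by (rule update_increases_state_order)
    have "\<exists>q'\<in>optimal_paths u. (q', p) \<in> path_order \<and>
        (fare_state N q' = fare_state N q \<or> fare_state N q' <\<^sub>C fare_state N q)"
    proof (cases "q \<in> optimal_paths u")
      case True
      have "(q, p) \<in> path_order"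
        using q_p q(1,2) \<open>p \<in> paths v\<close> by (auto simp: path_order_def)
      with True show ?thesis by blast
    next
      case False
      then obtain q' where q': "q' \<in> optimal_paths u" "fare_state N q' <\<^sub>C fare_state N q"
        using q(2) optimal_path_below by blast
      then have "q' \<in> paths u" by (simp add: state_optimal_paths_def)
      then have "(fare_state N q', fare_state N q) \<in> state_order N"
        using q'(2) state_less_iff fare_state_in_fare_states by blast
      with q_p have "(fare_state N q', fare_state N p) \<in> state_order N"
        using transD[OF trans_state_order] by metis
      with \<open>q' \<in> paths u\<close> \<open>p \<in> paths v\<close> have "(q', p) \<in> path_order"
        by (auto simp: path_order_def)
      with q' show ?thesis by blast
    qed
    then obtain q' where q': "q' \<in> optimal_paths u" "(q', p) \<in> path_order"
      "fare_state N q' = fare_state N q \<or> fare_state N q' <\<^sub>C fare_state N q" by blast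
    from less.IH[OF q'(2,1)] obtain r where r: "r \<in> optimal_paths u"
      "fare_state N q' = fare_state N r"
      "\<forall>l < length r. take (Suc l) r \<in> optimal_paths (r ! l)" by blast
    have r_path: "r \<in> paths u" using r(1) by (simp add: state_optimal_paths_def)
    then have rv_path: "r @ [v] \<in> paths v" using q(3,4) by (rule st_paths_snocI)
    have rv_state: "fare_state N (r @ [v]) = update N (fare_state N r) (u, v)"
      using r_path by (rule fare_state_snoc)
    have same: "fare_state N (r @ [v]) = fare_state N p"
      using q'(3)
    proof
      assume "fare_state N q' = fare_state N q"
      then show ?thesis by (simp add: rv_state p_state r(2)[symmetric])
    next
      assume "fare_state N q' <\<^sub>C fare_state N q"
      then have "fare_state N r \<le>\<^sub>C fare_state N q" by (simp add: state_less_def r(2))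
      then have "fare_state N (r @ [v]) \<le>\<^sub>C fare_state N p"
        unfolding rv_state p_state
        using r_path q_fare q(3) fare_state_in_fare_states by (intro monotone) auto
      then show ?thesis using less.prems rv_path by (intro same_state_if_le_optimal)
    qed
    have rv_optimal: "r @ [v] \<in> optimal_paths v"
      using less.prems rv_path same by (rule state_optimal_path_if_same_state)
    have "take (Suc l) (r @ [v]) \<in> optimal_paths ((r @ [v]) ! l)" if "l < length (r @ [v])" for l
      using that r(3) rv_optimal by (cases "l < length r") (auto simp: nth_append less_Suc_eq)
    with rv_optimal same show ?thesis by (intro bexI[of _ "r @ [v]"]) auto
  qed
qed

end

theorem proposition4p1:
  fixes V :: "'v set" and A :: "('v \<times> 'v) set"
    and N :: "('v, 't, 'h::po_positive_monoid, 's) fare_network"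
    and CF CP CN :: "'t set" and s t :: 'v and pstar :: "'v list"
  assumes "digraph V A"
    and "conditional_fare_network V A N"
    and "ticket_partition (tickets N) CF CP CN"
    and "\<forall>f1\<in>fare_states N. \<forall>f2\<in>fare_states N. state_le N (CF, CP, CN) f1 f2 \<longrightarrow>
           (\<forall>a\<in>A. state_le N (CF, CP, CN) (update N f1 a) (update N f2 a))"
    and "s \<in> V" and "t \<in> V"
    and "pstar \<in> state_optimal_paths V A N (CF, CP, CN) s t"
  shows "\<exists>p'\<in>state_optimal_paths V A N (CF, CP, CN) s t.
           fare_state N pstar = fare_state N p' \<and>
           (\<forall>l < length p' - 1.
              take (Suc l) p' \<in> state_optimal_paths V A N (CF, CP, CN) (p' ! 0) (p' ! l))"
proof -
  interpret monotone_fare_network V A N CF CP CN s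
    using assms by unfold_locales blast+
  from ex_prefix_optimal[OF assms(7)] obtain p' where p': "p' \<in> optimal_paths t"
    "fare_state N pstar = fare_state N p'"
    "\<forall>l < length p'. take (Suc l) p' \<in> optimal_paths (p' ! l)" by blast
  moreover from p'(1) have "p' ! 0 = s"
    by (auto simp: state_optimal_paths_def st_paths_def hd_conv_nth)
  ultimately show ?thesis by (intro bexI[of _ p']) auto
qed

end
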